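(* Let $R$ be a commutative Noetherian ring. For any regular ideal $I$ of $R$, there exists a regular ideal $J$ of $R$ such that $r(I,J)=\overline{I}$.
   Context: An ideal is regular if it contains a nonzerodivisor of $R$. $\overline{I}$ denotes the integral closure of $I$ in $R$. For a finitely generated $R$-module $M$ and submodules $A,B$ of $M$, $(A:B)=\{x\in R : xB\subseteq A\}$, and $r(I,M)=\bigcup_{k\geq 1}(I^{k+1}M:I^kM)$ (an ascending union of ideals of $R$). Here $r(I,J)$ is $r(I,M)$ for $M=J$ regarded as an $R$-module. *)

theory Defs
  imports "HOL-Algebra.Algebra"
begin

definition nonzerodivisor :: "('a, 'b) ring_scheme \<Rightarrow> 'a \<Rightarrow> bool"
  where "nonzerodivisor R a \<longleftrightarrow>
    a \<in> carrier R \<and> (\<forall>x\<in>carrier R. a \<otimes>\<^bsub>R\<^esub> x = \<zero>\<^bsub>R\<^esub> \<longrightarrow> x = \<zero>\<^bsub>R\<^esub>)"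

definition regular_ideal :: "'a set \<Rightarrow> ('a, 'b) ring_scheme \<Rightarrow> bool"
  where "regular_ideal I R \<longleftrightarrow> ideal I R \<and> (\<exists>a\<in>I. nonzerodivisor R a)"

text \<open>
  Ideal powers are powers in the multiplicative monoid \<^term>\<open>ideals_set R\<close> of ideals, so the
  zeroth power is the whole ring.
\<close>

abbreviation ideal_power :: "('a, 'b) ring_scheme \<Rightarrow> 'a set \<Rightarrow> nat \<Rightarrow> 'a set"
  where "ideal_power R I k \<equiv> I [^]\<^bsub>ideals_set R\<^esub> k"

text \<open>
  An element \<open>x\<close> is integral over \<open>I\<close> if \<open>x\<^sup>n + a\<^sub>1 x\<^sup>n\<^sup>-\<^sup>1 + \<dots> + a\<^sub>n = 0\<close>
  for some \<open>n \<ge> 1\<close> and some \<open>a\<^sub>i \<in> I\<^sup>i\<close>.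
\<close>

definition integral_over_ideal :: "('a, 'b) ring_scheme \<Rightarrow> 'a set \<Rightarrow> 'a \<Rightarrow> bool"
  where "integral_over_ideal R I x \<longleftrightarrow>
    (\<exists>n::nat. n \<ge> 1 \<and> (\<exists>a. (\<forall>i\<in>{1..n}. a i \<in> ideal_power R I i) \<and>
      x [^]\<^bsub>R\<^esub> n \<oplus>\<^bsub>R\<^esub> (\<Oplus>\<^bsub>R\<^esub>i\<in>{1..n}. a i \<otimes>\<^bsub>R\<^esub> x [^]\<^bsub>R\<^esub> (n - i)) = \<zero>\<^bsub>R\<^esub>))"

definition integral_closure :: "('a, 'b) ring_scheme \<Rightarrow> 'a set \<Rightarrow> 'a set"
  where "integral_closure R I = {x \<in> carrier R. integral_over_ideal R I x}"

text \<open>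
  The submodule \<open>I N\<close>, consisting of the finite nonempty sums of products \<open>a x\<close> with
  \<open>a \<in> I\<close> and \<open>x \<in> N\<close>, in the same style as \<^const>\<open>ideal_prod\<close>. It is meant for an ideal \<open>I\<close>
  and a submodule \<open>N\<close>, where the zero element and negatives come for free.
\<close>

inductive_set ideal_smult :: "('a, 'm, 'c) module_scheme \<Rightarrow> 'a set \<Rightarrow> 'm set \<Rightarrow> 'm set"
  for M and I and N where
    smult: "\<lbrakk> a \<in> I; x \<in> N \<rbrakk> \<Longrightarrow> a \<odot>\<^bsub>M\<^esub> x \<in> ideal_smult M I N"
  | add: "\<lbrakk> x \<in> ideal_smult M I N; y \<in> ideal_smult M I N \<rbrakk> \<Longrightarrow> x \<oplus>\<^bsub>M\<^esub> y \<in> ideal_smult M I N"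

definition submodule_colon ::
    "('a, 'b) ring_scheme \<Rightarrow> ('a, 'm, 'c) module_scheme \<Rightarrow> 'm set \<Rightarrow> 'm set \<Rightarrow> 'a set"
  where "submodule_colon R M A B = {r \<in> carrier R. \<forall>b\<in>B. r \<odot>\<^bsub>M\<^esub> b \<in> A}"

definition ideal_r :: "('a, 'b) ring_scheme \<Rightarrow> 'a set \<Rightarrow> ('a, 'm, 'c) module_scheme \<Rightarrow> 'a set"
  where "ideal_r R I M =
    (\<Union>k\<in>{1..}. submodule_colon R M
      (ideal_smult M (ideal_power R I (Suc k)) (carrier M))
      (ideal_smult M (ideal_power R I k) (carrier M)))"

text \<open>
  An ideal as a module over the ring. The module record extends the ring record, so the fields
  \<^const>\<open>mult\<close> and \<^const>\<open>one\<close> have to be given; the module structure does not use them.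
\<close>

definition ideal_module :: "('a, 'b) ring_scheme \<Rightarrow> 'a set \<Rightarrow> ('a, 'a) module"
  where "ideal_module R J =
    \<lparr> carrier = J, monoid.mult = monoid.mult R, monoid.one = monoid.one R,
      ring.zero = ring.zero R, ring.add = ring.add R, module.smult = monoid.mult R \<rparr>"

lemma (in cring) ideal_module_is_module:
  assumes "ideal J R"
  shows "module R (ideal_module R J)"
proof -
  interpret J: ideal J R by fact
  show ?thesis
  proof (rule moduleI)
    show "cring R" by (rule cring_axioms)
    show "abelian_group (ideal_module R J)"
    proof (rule abelian_groupI)
      fix x assume "x \<in> carrier (ideal_module R J)"
      then have "x \<in> J" by (simp add: ideal_module_def)
      then show "\<exists>y\<in>carrier (ideal_module R J). y \<oplus>\<^bsub>ideal_module R J\<^esub> x = \<zero>\<^bsub>ideal_module R J\<^esub>"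
        by (intro bexI[of _ "\<ominus> x"]) (auto simp: ideal_module_def J.Icarr l_neg)
    qed (auto simp: ideal_module_def J.Icarr a_ac)
  qed (auto simp: ideal_module_def J.Icarr J.I_l_closed l_distr r_distr m_assoc)
qed

lemma ideal_smult_ideal_module: "ideal_smult (ideal_module R J) I N = ideal_prod R I N"
proof (intro equalityI subsetI)
  fix x assume "x \<in> ideal_smult (ideal_module R J) I N"
  then show "x \<in> ideal_prod R I N"
    by induct (auto simp: ideal_module_def intro: ideal_prod.intros)
next
  fix x assume "x \<in> ideal_prod R I N"
  then show "x \<in> ideal_smult (ideal_module R J) I N"
    by induct (use ideal_smult.intros[where M = "ideal_module R J" and I = I and N = N] in
      \<open>auto simp: ideal_module_def\<close>)
qed

end

theory Submission
  imports Defs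
begin

text \<open>
  Call \<open>(I J : J)\<close> the ideal of those \<open>x\<close> with \<open>x J \<subseteq> I J\<close>. Since \<open>I\<^sup>k\<^sup>+\<^sup>1 J = I (I\<^sup>k J)\<close>, the set
  \<open>r(I, J)\<close> is the union of the ideals \<open>(I N : N)\<close> for \<open>N = I\<^sup>k J\<close> with \<open>k \<ge> 1\<close>, and these \<open>N\<close> are
  regular when \<open>I\<close> and \<open>J\<close> are (lemma \<open>ideal_r_ideal_module\<close>). Three facts then give the result.

  \<^item> If \<open>N\<close> is finitely generated and regular, every \<open>x\<close> with \<open>x N \<subseteq> I N\<close> is integral over \<open>I\<close>
    (\<open>integral_if_mult_subset\<close>). This is the determinant trick. Here the determinant is replaced by
    an elimination of one generator of \<open>N\<close> after the other (\<open>monic_elimination\<close>).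

  \<^item> Every \<open>x\<close> integral over a regular \<open>I\<close> lies in \<open>(I J : J)\<close> for some regular \<open>J\<close>, namely for a
    power \<open>J\<close> of \<open>L = I + R x\<close> (\<open>integral_imp_reducing\<close>).

  \<^item> Multiplying \<open>J\<close> by a further ideal can only enlarge \<open>(I J : J)\<close>
    (\<open>reducing_elements_prod\<close>), so these colon ideals form a directed family. In a Noetherian ring
    the family has a maximal member (\<open>ideal_family_has_maximal\<close>), which by directedness contains
    all the others.

  Take \<open>J\<close> for which \<open>(I J : J)\<close> is this largest member. It contains the integral closure by the
  second fact, it is contained in \<open>r(I, J)\<close> by the third, and \<open>r(I, J)\<close> consists of integral
  elements by the first.

  Integrality enters both facts through one membership that avoids coefficients: \<open>x\<close> is
  integral over \<open>I\<close> iff \<open>x\<^sup>d\<^sup>+\<^sup>1 \<in> I L\<^sup>d\<close> for some \<open>d\<close> (\<open>integral_over_ideal_iff\<close>).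
\<close>

section \<open>Ideal arithmetic\<close>

no_notation Sum_Type.Plus (infixr \<open><+>\<close> 65)

text \<open>
  The simplifier would rewrite powers of ideals into products in the monoid of ideals, where the
  laws for \<^const>\<open>ideal_prod\<close> no longer apply.
\<close>

declare nat_pow_Suc [simp del] nat_pow_0 [simp del]

context cring
begin

(* This is the instance of the rule for powers of ring elements. The leading terms x^(d+1) below
   are handled as a whole. *)
declare nat_pow_Suc [simp del]

lemma ideal_prod_subset:
  assumes "ideal T R" "\<And>i j. i \<in> I \<Longrightarrow> j \<in> J \<Longrightarrow> i \<otimes> j \<in> T"
  shows "I \<cdot> J \<subseteq> T"
proof
  interpret T: ideal T R by fact
  fix z assume "z \<in> I \<cdot> J"
  then show "z \<in> T" by induct (auto intro: assms)
qed

lemma ideal_prod_mono: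
  assumes "I \<subseteq> I'" "J \<subseteq> J'"
  shows "I \<cdot> J \<subseteq> I' \<cdot> J'"
proof
  fix z assume "z \<in> I \<cdot> J"
  then show "z \<in> I' \<cdot> J'"
    by induct (use assms in \<open>auto intro: ideal_prod.intros\<close>)
qed

lemma ideal_prod_left_commute:
  assumes "ideal I R" "ideal J R" "ideal K R"
  shows "I \<cdot> (J \<cdot> K) = J \<cdot> (I \<cdot> K)"
  using assms by (metis ideal_prod_assoc ideal_prod_commute)

lemma mult_ideal_prod_left:
  assumes "v \<in> carrier R" "ideal K R" "ideal N R" "\<And>k. k \<in> K \<Longrightarrow> v \<otimes> k \<in> K'"
    and "z \<in> K \<cdot> N"
  shows "v \<otimes> z \<in> K' \<cdot> N"
  using assms(5)
proof induct
  case (prod i j)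
  then have "v \<otimes> (i \<otimes> j) = (v \<otimes> i) \<otimes> j"
    using assms(1-3) ideal.Icarr by (metis m_assoc)
  then show ?case using prod assms(4) by (simp add: ideal_prod.prod)
next
  case (sum s1 s2)
  then have "s1 \<in> carrier R" "s2 \<in> carrier R"
    using ideal_prod_in_carrier[OF assms(2,3)] by auto
  then show ?case using sum assms(1) by (simp add: r_distr ideal_prod.sum)
qed

lemma ideal_prod_cgenideal:
  assumes "ideal K R" "y \<in> carrier R" "z \<in> K \<cdot> (PIdl y)"
  shows "\<exists>c\<in>K. z = c \<otimes> y"
  using assms(3)
proof induct
  interpret K: ideal K R by fact
  {
    case (prod i j)
    then obtain r where "r \<in> carrier R" "j = r \<otimes> y" by (auto simp: cgenideal_def)
    then show ?case
      using prod assms(2) by (intro bexI[of _ "i \<otimes> r"]) (auto simp: m_assoc K.I_r_closed K.Icarr)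
  next
    case (sum s1 s2)
    then obtain c c' where "c \<in> K" "c' \<in> K" "s1 = c \<otimes> y" "s2 = c' \<otimes> y" by auto
    then show ?case
      using assms(2) by (intro bexI[of _ "c \<oplus> c'"]) (auto simp: l_distr K.Icarr)
  }
qed

lemma set_addE:
  assumes "z \<in> A <+> B"
  obtains a b where "a \<in> A" "b \<in> B" "z = a \<oplus> b"
  using assms by (auto simp: set_add_def')

lemma set_addI: "a \<in> A \<Longrightarrow> b \<in> B \<Longrightarrow> a \<oplus> b \<in> A <+> B"
  by (auto simp: set_add_def')

lemma ideal_subset_set_add:
  assumes "ideal A R" "ideal B R"
  shows "A \<subseteq> A <+> B" and "B \<subseteq> A <+> B"
proof -
  interpret A: ideal A R by fact
  interpret B: ideal B R by fact
  show "A \<subseteq> A <+> B"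
    using set_addI[of _ A \<zero> B] A.Icarr by fastforce
  show "B \<subseteq> A <+> B"
    using set_addI[of \<zero> A _ B] B.Icarr by fastforce
qed

text \<open>
  This is the step that isolates one generator \<open>y\<close> in the elimination: a linear combination of
  generators with coefficients in \<open>K\<close> is split into its \<open>y\<close>-term and the rest.
\<close>

lemma ideal_prod_Idl_insert:
  assumes "ideal K R" "y \<in> carrier R" "S \<subseteq> carrier R" "z \<in> K \<cdot> (Idl (insert y S))"
  shows "\<exists>b\<in>K. \<exists>c\<in>K \<cdot> (Idl S). z = b \<otimes> y \<oplus> c"
proof -
  have id: "ideal (PIdl y) R" "ideal (Idl S) R"
    using assms cgenideal_ideal genideal_ideal by auto
  have "Idl (insert y S) \<subseteq> PIdl y <+> Idl S"
  proof (rule genideal_minimal)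
    show "ideal (PIdl y <+> Idl S) R" using id by (rule add_ideals)
    show "insert y S \<subseteq> PIdl y <+> Idl S"
      using ideal_subset_set_add[OF id] cgenideal_self[OF assms(2)] genideal_self[OF assms(3)]
      by auto
  qed
  then have "z \<in> K \<cdot> (PIdl y <+> Idl S)"
    using assms(4) ideal_prod_mono[of K K] by blast
  then have "z \<in> K \<cdot> (PIdl y) <+> K \<cdot> (Idl S)"
    using ideal_prod_distr(1)[OF assms(1) id] by simp
  then show ?thesis
    using ideal_prod_cgenideal[OF assms(1,2)] by (blast elim: set_addE)
qed

lemma ideal_power_ideal [simp]:
  assumes "ideal I R"
  shows "ideal (ideal_power R I k) R"
proof -
  interpret M: comm_monoid "ideals_set R" by (rule ideals_set_is_comm_monoid)
  have "I \<in> carrier (ideals_set R)" using assms by (simp add: ideals_set_def)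
  from M.nat_pow_closed[OF this, of k] show ?thesis by (simp add: ideals_set_def)
qed

lemma ideal_power_0: "ideal_power R I 0 = carrier R"
  by (simp add: nat_pow_def ideals_set_def)

lemma ideal_power_Suc:
  assumes "ideal I R"
  shows "ideal_power R I (Suc k) = I \<cdot> ideal_power R I k"
proof -
  interpret M: comm_monoid "ideals_set R" by (rule ideals_set_is_comm_monoid)
  have "I \<in> carrier (ideals_set R)" using assms by (simp add: ideals_set_def)
  from M.nat_pow_Suc2[OF this, of k] show ?thesis by (simp add: ideals_set_def)
qed

lemma ideal_power_1:
  assumes "ideal I R"
  shows "ideal_power R I (Suc 0) = I"
  using assms by (simp add: ideal_power_Suc ideal_power_0 ideal_prod_one)

lemma ideal_power_add:
  assumes "ideal I R"
  shows "ideal_power R I k \<cdot> ideal_power R I l = ideal_power R I (k + l)"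
proof -
  interpret M: comm_monoid "ideals_set R" by (rule ideals_set_is_comm_monoid)
  have "I \<in> carrier (ideals_set R)" using assms by (simp add: ideals_set_def)
  from M.nat_pow_mult[OF this, of k l] show ?thesis by (simp add: ideals_set_def)
qed

lemma pow_mem_ideal_power:
  assumes "ideal I R" "x \<in> I"
  shows "x [^] k \<in> ideal_power R I k"
proof (induct k)
  case 0 then show ?case by (simp add: ideal_power_0)
next
  case (Suc k)
  have "x \<in> carrier R" using assms ideal.Icarr by fast
  then have "x [^] Suc k = x \<otimes> x [^] k" by (rule nat_pow_Suc2)
  then show ?case using Suc assms by (simp add: ideal_power_Suc ideal_prod.prod)
qed

lemma ideal_power_mono:
  assumes "I \<subseteq> J" "ideal I R" "ideal J R"
  shows "ideal_power R I k \<subseteq> ideal_power R J k"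
proof (induct k)
  case 0 then show ?case by (simp add: ideal_power_0)
next
  case (Suc k)
  from ideal_prod_mono[OF assms(1) this] show ?case by (simp add: ideal_power_Suc assms(2,3))
qed

section \<open>Regular ideals\<close>

lemma nonzerodivisor_mult:
  assumes "nonzerodivisor R a" "nonzerodivisor R b"
  shows "nonzerodivisor R (a \<otimes> b)"
  using assms unfolding nonzerodivisor_def by (metis m_assoc m_closed)

lemma regular_ideal_prod:
  assumes "regular_ideal I R" "regular_ideal J R"
  shows "regular_ideal (I \<cdot> J) R"
  using assms unfolding regular_ideal_def
  by (meson ideal_prod.prod ideal_prod_is_ideal nonzerodivisor_mult)

lemma regular_ideal_carrier: "regular_ideal (carrier R) R"
  unfolding regular_ideal_def nonzerodivisor_def using oneideal by (auto intro!: bexI[of _ \<one>])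

lemma regular_ideal_power:
  assumes "regular_ideal I R"
  shows "regular_ideal (ideal_power R I k) R"
proof (induct k)
  case 0 then show ?case by (simp add: ideal_power_0 regular_ideal_carrier)
next
  case (Suc k)
  have "ideal I R" using assms by (simp add: regular_ideal_def)
  then show ?case using Suc assms by (simp add: ideal_power_Suc regular_ideal_prod)
qed

lemma regular_ideal_mono:
  assumes "regular_ideal I R" "I \<subseteq> J" "ideal J R"
  shows "regular_ideal J R"
  using assms unfolding regular_ideal_def by blast

section \<open>Integral dependence and powers of \<open>I + R x\<close>\<close>

lemma ideal_adjoin:
  assumes I: "ideal I R" and x: "x \<in> carrier R"
  shows "ideal (I <+> PIdl x) R" and "I \<subseteq> I <+> PIdl x" and "x \<in> I <+> PIdl x"
proof -
  have P: "ideal (PIdl x) R" using x by (rule cgenideal_ideal)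
  show "ideal (I <+> PIdl x) R" using I P by (rule add_ideals)
  show "I \<subseteq> I <+> PIdl x" by (rule ideal_subset_set_add(1)[OF I P])
  show "x \<in> I <+> PIdl x" using ideal_subset_set_add(2)[OF I P] cgenideal_self[OF x] by auto
qed

text \<open>
  Expanding \<open>(I + R x)\<^sup>d\<^sup>+\<^sup>1\<close>, every product with at least one factor from \<open>I\<close> lies in \<open>I L\<^sup>d\<close>, and
  only \<open>x\<^sup>d\<^sup>+\<^sup>1\<close> is left over. Hence \<open>L\<^sup>d\<^sup>+\<^sup>1 = I L\<^sup>d\<close> as soon as \<open>x\<^sup>d\<^sup>+\<^sup>1 \<in> I L\<^sup>d\<close>.
\<close>

lemma ideal_power_adjoin_split_top:
  assumes I: "ideal I R" and x: "x \<in> carrier R"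
  defines "L \<equiv> I <+> PIdl x"
  shows "ideal_power R L (Suc d) \<subseteq> I \<cdot> ideal_power R L d <+> PIdl (x [^] Suc d)"
proof (induct d)
  have L: "ideal L R" unfolding L_def using I x by (rule ideal_adjoin(1))
  case 0
  show ?case
    using I L x by (simp add: ideal_power_1 ideal_power_0 ideal_prod_one) (simp add: L_def nat_pow_Suc)
next
  have L: "ideal L R" unfolding L_def using I x by (rule ideal_adjoin(1))
  have xL: "x \<in> L" unfolding L_def using I x by (rule ideal_adjoin(3))
  case (Suc d)
  let ?X = "x [^] Suc d"
  let ?A = "I \<cdot> ideal_power R L (Suc d)" and ?B = "PIdl (x [^] Suc (Suc d))"
  have X: "?X \<in> carrier R" "x [^] Suc (Suc d) = x \<otimes> ?X"
    using x nat_pow_Suc2[OF x, of "Suc d"] by auto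
  have idA: "ideal ?A R" using I L by (simp add: ideal_prod_is_ideal)
  have idB: "ideal ?B R" using x by (simp add: cgenideal_ideal)
  have idT: "ideal (?A <+> ?B) R" using idA idB by (rule add_ideals)
  interpret T: ideal "?A <+> ?B" R by (rule idT)
  interpret I: ideal I R by (rule I)
  interpret LL: ideal L R by (rule L)
  have "L \<cdot> ideal_power R L (Suc d) \<subseteq> ?A <+> ?B"
  proof (rule ideal_prod_subset[OF idT])
    fix l k assume l: "l \<in> L" and k: "k \<in> ideal_power R L (Suc d)"
    then obtain u r' where u: "u \<in> I \<cdot> ideal_power R L d" and r': "r' \<in> carrier R"
      and k': "k = u \<oplus> r' \<otimes> ?X"
      using Suc by (force elim!: set_addE simp: cgenideal_def)
    from l obtain i r where i: "i \<in> I" and r: "r \<in> carrier R" and l': "l = i \<oplus> r \<otimes> x"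
      unfolding L_def by (force elim!: set_addE simp: cgenideal_def)
    have uc: "u \<in> carrier R"
      using u I L ideal_prod_in_carrier[of I "ideal_power R L d"] by auto
    have "l \<otimes> u \<in> L \<cdot> (I \<cdot> ideal_power R L d)" using l u by (rule ideal_prod.prod)
    also have "\<dots> = ?A" using I L by (simp add: ideal_power_Suc ideal_prod_left_commute)
    finally have 1: "l \<otimes> u \<in> ?A <+> ?B" using ideal_subset_set_add(1)[OF idA idB] by blast
    have "(i \<otimes> r') \<otimes> ?X \<in> ?A"
      using i r' I.I_r_closed pow_mem_ideal_power[OF L xL] by (blast intro: ideal_prod.prod)
    then have 2: "(i \<otimes> r') \<otimes> ?X \<in> ?A <+> ?B" using ideal_subset_set_add(1)[OF idA idB] by blast
    have "(r \<otimes> r') \<otimes> (x \<otimes> ?X) \<in> ?B" using r r' unfolding X(2) cgenideal_def by auto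
    then have 3: "(r \<otimes> r') \<otimes> (x \<otimes> ?X) \<in> ?A <+> ?B"
      using ideal_subset_set_add(2)[OF idA idB] by blast
    have 4: "l \<otimes> (r' \<otimes> Y) = (i \<otimes> r') \<otimes> Y \<oplus> (r \<otimes> r') \<otimes> (x \<otimes> Y)" if "Y \<in> carrier R" for Y
      using that r r' x I.Icarr[OF i] unfolding l' by algebra
    have "l \<otimes> k = l \<otimes> u \<oplus> l \<otimes> (r' \<otimes> ?X)"
      unfolding k' by (rule r_distr) (use uc X(1) r' LL.Icarr[OF l] in simp_all)
    also have "\<dots> = l \<otimes> u \<oplus> ((i \<otimes> r') \<otimes> ?X \<oplus> (r \<otimes> r') \<otimes> (x \<otimes> ?X))"
      unfolding 4[OF X(1)] ..
    finally have "l \<otimes> k = l \<otimes> u \<oplus> ((i \<otimes> r') \<otimes> ?X \<oplus> (r \<otimes> r') \<otimes> (x \<otimes> ?X))" .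
    then show "l \<otimes> k \<in> ?A <+> ?B" using 1 2 3 by auto
  qed
  then show ?case using ideal_power_Suc[OF L, of "Suc d"] by simp
qed

text \<open>
  The opposite grouping of the same expansion: every product with a factor \<open>x\<close> lies in \<open>L\<^sup>d x\<close>,
  and only \<open>I\<^sup>d\<^sup>+\<^sup>1\<close> is left over. Iterating this splits off the coefficients of an equation of
  integral dependence, the constant term first.
\<close>

lemma ideal_power_adjoin_split_bottom:
  assumes I: "ideal I R" and x: "x \<in> carrier R"
  defines "L \<equiv> I <+> PIdl x"
  shows "ideal_power R L (Suc d) \<subseteq> ideal_power R I (Suc d) <+> ideal_power R L d \<cdot> (PIdl x)"
proof (induct d)
  have L: "ideal L R" unfolding L_def using I x by (rule ideal_adjoin(1))
  case 0
  have "ideal (PIdl x) R" using x by (rule cgenideal_ideal)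
  then show ?case
    using I L
    by (simp add: ideal_power_1 ideal_power_0 ideal_prod_one ideal_prod_commute[OF oneideal])
      (simp add: L_def)
next
  have L: "ideal L R" unfolding L_def using I x by (rule ideal_adjoin(1))
  have P: "ideal (PIdl x) R" using x by (rule cgenideal_ideal)
  have IL: "I \<subseteq> L" unfolding L_def using I x by (rule ideal_adjoin(2))
  case (Suc d)
  let ?A = "ideal_power R I (Suc (Suc d))" and ?B = "ideal_power R L (Suc d) \<cdot> (PIdl x)"
  have idA: "ideal ?A R" using I by simp
  have idB: "ideal ?B R" using L P by (simp add: ideal_prod_is_ideal)
  have idT: "ideal (?A <+> ?B) R" using idA idB by (rule add_ideals)
  interpret T: ideal "?A <+> ?B" R by (rule idT)
  interpret I: ideal I R by (rule I)
  interpret Id: ideal "ideal_power R I (Suc d)" R using I by simp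
  interpret Ld: ideal "ideal_power R L d" R using L by simp
  interpret Lk: ideal "ideal_power R L (Suc d)" R using L by simp
  have "L \<cdot> ideal_power R L (Suc d) \<subseteq> ?A <+> ?B"
  proof (rule ideal_prod_subset[OF idT])
    fix l k assume l: "l \<in> L" and k: "k \<in> ideal_power R L (Suc d)"
    from subsetD[OF Suc k] obtain b y where b: "b \<in> ideal_power R I (Suc d)"
      and y: "y \<in> ideal_power R L d \<cdot> (PIdl x)" and kby: "k = b \<oplus> y" by (rule set_addE)
    from ideal_prod_cgenideal[OF ideal_power_ideal[OF L] x y] obtain c
      where c: "c \<in> ideal_power R L d" and "y = c \<otimes> x" ..
    with kby have k': "k = b \<oplus> c \<otimes> x" by simp
    from l obtain i r where i: "i \<in> I" and r: "r \<in> carrier R" and l': "l = i \<oplus> r \<otimes> x"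
      unfolding L_def by (force elim!: set_addE simp: cgenideal_def)
    have "i \<otimes> b \<in> ?A" using i b ideal_power_Suc[OF I, of "Suc d"] by (simp add: ideal_prod.prod)
    then have 1: "i \<otimes> b \<in> ?A <+> ?B" using ideal_subset_set_add(1)[OF idA idB] by blast
    have "i \<otimes> c \<in> ideal_power R L (Suc d)"
      using i c IL by (auto simp: ideal_power_Suc[OF L] intro: ideal_prod.prod)
    moreover have "r \<otimes> k \<in> ideal_power R L (Suc d)" using Lk.I_l_closed[OF k r] .
    ultimately have "(i \<otimes> c \<oplus> r \<otimes> k) \<otimes> x \<in> ?B"
      by (intro ideal_prod.prod cgenideal_self x) auto
    then have 2: "(i \<otimes> c \<oplus> r \<otimes> k) \<otimes> x \<in> ?A <+> ?B"
      using ideal_subset_set_add(2)[OF idA idB] by blast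
    have "l \<otimes> k = i \<otimes> k \<oplus> (r \<otimes> k) \<otimes> x"
      using Lk.Icarr[OF k] r x I.Icarr[OF i] unfolding l' by algebra
    also have "i \<otimes> k = i \<otimes> b \<oplus> (i \<otimes> c) \<otimes> x"
      using Id.Icarr[OF b] Ld.Icarr[OF c] x I.Icarr[OF i] unfolding k' by algebra
    finally have "l \<otimes> k = i \<otimes> b \<oplus> (i \<otimes> c \<oplus> r \<otimes> k) \<otimes> x"
      using Id.Icarr[OF b] Ld.Icarr[OF c] Lk.Icarr[OF k] r x I.Icarr[OF i] by algebra
    then show "l \<otimes> k \<in> ?A <+> ?B" using 1 2 by auto
  qed
  then show ?case using ideal_power_Suc[OF L, of "Suc d"] by simp
qed

lemma ideal_power_adjoin_expansion:
  assumes I: "ideal I R" and x: "x \<in> carrier R"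
    and z: "z \<in> I \<cdot> ideal_power R (I <+> PIdl x) d"
  shows "\<exists>a. (\<forall>i\<in>{1..Suc d}. a i \<in> ideal_power R I i) \<and>
    z = (\<Oplus>i\<in>{1..Suc d}. a i \<otimes> x [^] (Suc d - i))"
  using z
proof (induct d arbitrary: z)
  case 0
  then have "z \<in> I" using I by (simp add: ideal_power_0 ideal_prod_one)
  then show ?case
    using I ideal.Icarr[OF I] by (intro exI[of _ "\<lambda>_. z"]) (simp add: ideal_power_1)
next
  case (Suc d)
  let ?L = "I <+> PIdl x"
  have P: "ideal (PIdl x) R" using x by (rule cgenideal_ideal)
  have L: "ideal ?L R" using I P by (rule add_ideals)
  have "z \<in> I \<cdot> (ideal_power R I (Suc d) <+> ideal_power R ?L d \<cdot> (PIdl x))"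
    using Suc.prems ideal_prod_mono[OF order_refl ideal_power_adjoin_split_bottom[OF I x]] by blast
  also have "\<dots> = ideal_power R I (Suc (Suc d)) <+> (I \<cdot> ideal_power R ?L d) \<cdot> (PIdl x)"
    using I L P
    by (simp add: ideal_prod_distr ideal_prod_is_ideal ideal_prod_assoc ideal_power_Suc[OF I, of "Suc d"])
  finally obtain b y where b: "b \<in> ideal_power R I (Suc (Suc d))"
    and y: "y \<in> (I \<cdot> ideal_power R ?L d) \<cdot> (PIdl x)" and "z = b \<oplus> y" by (rule set_addE)
  moreover from ideal_prod_cgenideal[OF ideal_prod_is_ideal[OF I ideal_power_ideal[OF L]] x y]
  obtain c where c: "c \<in> I \<cdot> ideal_power R ?L d" and "y = c \<otimes> x" ..
  ultimately have zbc: "z = b \<oplus> c \<otimes> x" by simp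
  from Suc.hyps[OF c] obtain a where a: "\<And>i. i \<in> {1..Suc d} \<Longrightarrow> a i \<in> ideal_power R I i"
    and c': "c = (\<Oplus>i\<in>{1..Suc d}. a i \<otimes> x [^] (Suc d - i))" by blast
  have ac: "a i \<in> carrier R" if "i \<in> {1..Suc d}" for i
    using a[OF that] ideal.Icarr[OF ideal_power_ideal[OF I]] by blast
  have bc: "b \<in> carrier R" using b ideal.Icarr[OF ideal_power_ideal[OF I]] by blast
  let ?a = "a(Suc (Suc d) := b)"
  have "c \<otimes> x = (\<Oplus>i\<in>{1..Suc d}. (a i \<otimes> x [^] (Suc d - i)) \<otimes> x)"
    unfolding c' by (rule finsum_ldistr) (use ac x in auto)
  also have "\<dots> = (\<Oplus>i\<in>{1..Suc d}. ?a i \<otimes> x [^] (Suc (Suc d) - i))"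
  proof (rule add.finprod_cong')
    fix i assume i: "i \<in> {1..Suc d}"
    then have "Suc (Suc d) - i = Suc (Suc d - i)" by auto
    then show "(a i \<otimes> x [^] (Suc d - i)) \<otimes> x = ?a i \<otimes> x [^] (Suc (Suc d) - i)"
      using i x ac[OF i] by (simp add: m_assoc nat_pow_Suc)
  qed (use ac x in auto)
  finally have cx: "c \<otimes> x = (\<Oplus>i\<in>{1..Suc d}. ?a i \<otimes> x [^] (Suc (Suc d) - i))" .
  have "(\<Oplus>i\<in>{1..Suc (Suc d)}. ?a i \<otimes> x [^] (Suc (Suc d) - i)) =
    b \<oplus> (\<Oplus>i\<in>{1..Suc d}. ?a i \<otimes> x [^] (Suc (Suc d) - i))"
  proof -
    have "{1..Suc (Suc d)} = insert (Suc (Suc d)) {1..Suc d}" by auto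
    then show ?thesis
      using bc ac x by (simp only:) (subst finsum_insert, auto)
  qed
  then have "z = (\<Oplus>i\<in>{1..Suc (Suc d)}. ?a i \<otimes> x [^] (Suc (Suc d) - i))"
    using zbc cx by simp
  moreover have "\<forall>i\<in>{1..Suc (Suc d)}. ?a i \<in> ideal_power R I i" using a b by auto
  ultimately show ?case by blast
qed

text \<open>
  An equation of integral dependence says that \<open>x\<^sup>d\<^sup>+\<^sup>1\<close> is a combination of the \<open>I\<^sup>i x\<^sup>d\<^sup>+\<^sup>1\<^sup>-\<^sup>i\<close>
  with \<open>1 \<le> i \<le> d + 1\<close>, and the sum of these is \<open>I L\<^sup>d\<close>
  with \<open>L = I + R x\<close>.
\<close>

lemma integral_over_ideal_iff:
  assumes I: "ideal I R" and x: "x \<in> carrier R"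
  shows "integral_over_ideal R I x \<longleftrightarrow>
    (\<exists>d. x [^] Suc d \<in> I \<cdot> ideal_power R (I <+> PIdl x) d)"
proof
  let ?L = "I <+> PIdl x"
  note L = ideal_adjoin(1)[OF I x] and IL = ideal_adjoin(2)[OF I x]
    and xL = ideal_adjoin(3)[OF I x]
  {
    assume "integral_over_ideal R I x"
    then obtain n a where n: "n \<ge> 1" and a: "\<And>i. i \<in> {1..n} \<Longrightarrow> a i \<in> ideal_power R I i"
      and eq: "x [^] n \<oplus> (\<Oplus>i\<in>{1..n}. a i \<otimes> x [^] (n - i)) = \<zero>"
      unfolding integral_over_ideal_def by blast
    from n obtain d where d: "n = Suc d" by (cases n) auto
    let ?T = "I \<cdot> ideal_power R ?L d"
    interpret T: ideal ?T R using I L by (simp add: ideal_prod_is_ideal)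
    have mem: "a i \<otimes> x [^] (n - i) \<in> ?T" if i: "i \<in> {1..n}" for i
    proof -
      from i obtain j where j: "i = Suc j" by (cases i) auto
      then have dj: "d = j + (n - i)" using i d by auto
      have "a i \<otimes> x [^] (n - i) \<in> ideal_power R I i \<cdot> ideal_power R ?L (n - i)"
        using a[OF i] pow_mem_ideal_power[OF L xL] by (rule ideal_prod.prod)
      also have "\<dots> = I \<cdot> (ideal_power R I j \<cdot> ideal_power R ?L (n - i))"
        using I L by (simp add: j ideal_power_Suc ideal_prod_assoc)
      also have "\<dots> \<subseteq> I \<cdot> (ideal_power R ?L j \<cdot> ideal_power R ?L (n - i))"
        by (intro ideal_prod_mono order_refl ideal_power_mono IL I L)
      also have "\<dots> = ?T"
        using ideal_power_add[OF L, of j "n - i"] dj by simp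
      finally show ?thesis .
    qed
    have sumT: "(\<Oplus>i\<in>B. a i \<otimes> x [^] (n - i)) \<in> ?T" if "B \<subseteq> {1..n}" for B
    proof -
      have "finite B" using that finite_subset by blast
      then show ?thesis using that
      proof induct
        case empty
        then show ?case by simp
      next
        case (insert i B)
        then have "a i \<otimes> x [^] (n - i) \<in> ?T" using mem by auto
        moreover have "(\<lambda>i. a i \<otimes> x [^] (n - i)) \<in> B \<rightarrow> carrier R"
          using insert.prems mem T.Icarr by blast
        ultimately show ?case using insert by (subst finsum_insert) (auto dest: T.Icarr)
      qed
    qed
    let ?s = "\<Oplus>i\<in>{1..n}. a i \<otimes> x [^] (n - i)"
    have s: "?s \<in> ?T" by (rule sumT) simp
    have "x [^] n = \<ominus> ?s"
      using eq T.Icarr[OF s] x by (intro minus_equality[symmetric]) (auto)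
    then have "x [^] n \<in> ?T" using s by simp
    then show "\<exists>d. x [^] Suc d \<in> I \<cdot> ideal_power R ?L d" using d by blast
  next
    assume "\<exists>d. x [^] Suc d \<in> I \<cdot> ideal_power R ?L d"
    then obtain d where d: "x [^] Suc d \<in> I \<cdot> ideal_power R ?L d" ..
    interpret T: ideal "I \<cdot> ideal_power R ?L d" R using I L by (simp add: ideal_prod_is_ideal)
    have "\<ominus> (x [^] Suc d) \<in> I \<cdot> ideal_power R ?L d" using d by (rule T.a_inv_closed)
    from ideal_power_adjoin_expansion[OF I x this] obtain a
      where "\<forall>i\<in>{1..Suc d}. a i \<in> ideal_power R I i"
        "\<ominus> (x [^] Suc d) = (\<Oplus>i\<in>{1..Suc d}. a i \<otimes> x [^] (Suc d - i))" by blast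
    moreover have "x [^] Suc d \<oplus> \<ominus> (x [^] Suc d) = \<zero>" using x by (simp add: r_neg)
    ultimately show "integral_over_ideal R I x"
      unfolding integral_over_ideal_def by (intro exI[of _ "Suc d"] conjI exI[of _ a]) simp_all
  }
qed

section \<open>Elimination in place of determinants\<close>

lemma annihilator_Idl:
  assumes "w \<in> carrier R" "S \<subseteq> carrier R" "\<And>s. s \<in> S \<Longrightarrow> w \<otimes> s = \<zero>" "z \<in> Idl S"
  shows "w \<otimes> z = \<zero>"
proof -
  have "ideal {r \<in> carrier R. w \<otimes> r \<in> {\<zero>}} R"
    by (rule ideal.helper_max_prime[OF zeroideal is_cring assms(1)])
  then have "Idl S \<subseteq> {r \<in> carrier R. w \<otimes> r \<in> {\<zero>}}"
    by (rule genideal_minimal) (use assms in auto)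
  then show ?thesis using assms(4) by auto
qed

text \<open>
  Think of \<open>A d\<close> as the values at \<open>x\<close> of homogeneous forms of degree \<open>d + 1\<close> without leading
  term; then \<open>x\<^sup>d\<^sup>+\<^sup>1 - a\<close> with \<open>a \<in> A d\<close> is the value of a monic form, and monic times monic is monic.
  The hypothesis \<open>rel\<close> is a linear system for the generators \<open>S\<close> with monic entries on the
  diagonal and lower entries elsewhere. The conclusion, a monic element annihilating all of \<open>S\<close>, is
  what its determinant would provide.

  Gaussian elimination without division proves it. The relation for a generator \<open>y\<close> can be brought
  into the form \<open>v y = c\<close> with \<open>v\<close> monic and \<open>c\<close> a combination of the other generators.
  Multiplying the other relations by \<open>v\<close> and substituting \<open>c\<close> for \<open>v y\<close> gives a system of the same
  shape, in which \<open>d + 1\<close> is doubled and \<open>y\<close> does not occur. If \<open>w\<close> annihilates the other generators,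
  it annihilates \<open>c\<close>, so \<open>w v\<close> annihilates \<open>y\<close> as well.
\<close>

lemma monic_elimination:
  assumes A: "\<And>d. ideal (A d) R" and x: "x \<in> carrier R"
    and AA: "\<And>d e a b. a \<in> A d \<Longrightarrow> b \<in> A e \<Longrightarrow> a \<otimes> b \<in> A (Suc (d + e))"
    and xA: "\<And>d e b. b \<in> A e \<Longrightarrow> x [^] Suc d \<otimes> b \<in> A (Suc (d + e))"
    and S: "finite S" "S \<subseteq> carrier R"
    and rel: "\<And>s. s \<in> S \<Longrightarrow> \<exists>a\<in>A d. (x [^] Suc d \<ominus> a) \<otimes> s \<in> A d \<cdot> (Idl S)"
  shows "\<exists>e. \<exists>a\<in>A e. \<forall>s\<in>S. (x [^] Suc e \<ominus> a) \<otimes> s = \<zero>"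
proof -
  define M where "M = (\<lambda>d. {x [^] Suc d \<ominus> a | a. a \<in> A d})"
  have Ac: "a \<in> carrier R" if "a \<in> A d" for a d using ideal.Icarr[OF A that] .
  have Aadd: "a \<oplus> b \<in> A d" if "a \<in> A d" "b \<in> A d" for a b d
  proof -
    interpret ideal "A d" R by (rule A)
    show ?thesis using that by simp
  qed
  have Aneg: "\<ominus> a \<in> A d" if "a \<in> A d" for a d
  proof -
    interpret ideal "A d" R by (rule A)
    show ?thesis using that by simp
  qed
  have Mc: "w \<in> carrier R" if "w \<in> M d" for w d
    using that Ac x unfolding M_def by auto
  have MA: "w \<otimes> b \<in> A (Suc (d + e))" if w: "w \<in> M d" and b: "b \<in> A e" for w b d e
  proof -
    from w obtain a where a: "a \<in> A d" "w = x [^] Suc d \<ominus> a" unfolding M_def by auto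
    have "w \<otimes> b = x [^] Suc d \<otimes> b \<oplus> \<ominus> (a \<otimes> b)"
      using Ac[OF a(1)] Ac[OF b] x unfolding a(2)
      by (simp add: a_minus_def l_distr l_minus)
    then show ?thesis using Aadd[OF xA[OF b, of d] Aneg[OF AA[OF a(1) b]]] by simp
  qed
  have MM: "v \<otimes> w \<in> M (Suc (d + e))" if v: "v \<in> M d" and w: "w \<in> M e" for v w d e
  proof -
    from v obtain a where a: "a \<in> A d" "v = x [^] Suc d \<ominus> a" unfolding M_def by auto
    from w obtain b where b: "b \<in> A e" "w = x [^] Suc e \<ominus> b" unfolding M_def by auto
    have c: "x [^] Suc e \<otimes> a \<oplus> v \<otimes> b \<in> A (Suc (d + e))"
      using Aadd[OF xA[OF a(1), of e] ] MA[OF v b(1)] by (simp add: add.commute)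
    have "x [^] Suc (Suc (d + e)) = x [^] Suc d \<otimes> x [^] Suc e"
      using x by (simp add: nat_pow_mult)
    then have "v \<otimes> w = x [^] Suc (Suc (d + e)) \<ominus> (x [^] Suc e \<otimes> a \<oplus> v \<otimes> b)"
      using Ac[OF a(1)] Ac[OF b(1)] x Mc[OF v] nat_pow_closed[OF x, of "Suc d"]
        nat_pow_closed[OF x, of "Suc e"]
      unfolding a(2) b(2) by algebra
    then show ?thesis using c unfolding M_def by blast
  qed
  \<comment> \<open>The degree varies in the induction because each elimination step doubles it.\<close>
  have "\<exists>e. \<exists>w\<in>M e. \<forall>s\<in>S. w \<otimes> s = \<zero>"
    if "\<And>s. s \<in> S \<Longrightarrow> \<exists>w\<in>M d. w \<otimes> s \<in> A d \<cdot> (Idl S)"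
    using S that
  proof (induct S arbitrary: d)
    case empty
    have "x [^] Suc d \<ominus> \<zero> \<in> M d"
      using additive_subgroup.zero_closed[OF ideal.axioms(1)[OF A]] unfolding M_def by blast
    then show ?case by blast
  next
    case (insert y S)
    have y: "y \<in> carrier R" and Sc: "S \<subseteq> carrier R" using insert.prems(1) by auto
    have idS: "ideal (Idl S) R" using Sc by (rule genideal_ideal)
    have split: "\<exists>w\<in>M d. \<exists>b\<in>A d. \<exists>c\<in>A d \<cdot> (Idl S). w \<otimes> s = b \<otimes> y \<oplus> c" if "s \<in> insert y S" for s
      using insert.prems(2)[OF that] ideal_prod_Idl_insert[OF A y Sc] by blast
    have prodc: "c \<in> carrier R" if "c \<in> A d \<cdot> (Idl S)" for c d
      using that ideal_prod_in_carrier[OF A idS] by blast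
    have prodadd: "u \<oplus> v \<in> A d \<cdot> (Idl S)" if "u \<in> A d \<cdot> (Idl S)" "v \<in> A d \<cdot> (Idl S)" for u v d
      using that by (rule ideal_prod.sum)
    from split[of y] obtain w b c where w: "w \<in> M d" and b: "b \<in> A d" and c: "c \<in> A d \<cdot> (Idl S)"
      and wy: "w \<otimes> y = b \<otimes> y \<oplus> c" by auto
    \<comment> \<open>The \<open>y\<close>-term on the right has a lower coefficient, so moving it to the left keeps
      the coefficient of \<open>y\<close> monic.\<close>
    define v where "v = w \<ominus> b"
    have v: "v \<in> M d"
    proof -
      from w obtain a where a: "a \<in> A d" "w = x [^] Suc d \<ominus> a" unfolding M_def by auto
      have "v = x [^] Suc d \<ominus> (a \<oplus> b)"
        unfolding v_def a(2) using Ac[OF a(1)] Ac[OF b] nat_pow_closed[OF x, of "Suc d"] by algebra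
      then show ?thesis using Aadd[OF a(1) b] unfolding M_def by blast
    qed
    have vy: "v \<otimes> y = c"
    proof -
      have "v \<otimes> y = w \<otimes> y \<ominus> b \<otimes> y"
        unfolding v_def using Mc[OF w] Ac[OF b] y by algebra
      also have "\<dots> = c" unfolding wy using prodc[OF c] Ac[OF b] y by algebra
      finally show ?thesis .
    qed
    let ?d = "Suc (d + d)"
    have rel': "\<exists>w\<in>M ?d. w \<otimes> s \<in> A ?d \<cdot> (Idl S)" if s: "s \<in> S" for s
    proof -
      from split[of s] s obtain u b' c' where u: "u \<in> M d" and b': "b' \<in> A d"
        and c': "c' \<in> A d \<cdot> (Idl S)" and us: "u \<otimes> s = b' \<otimes> y \<oplus> c'" by auto
      have sc: "s \<in> carrier R" using s Sc by blast
      have "(v \<otimes> u) \<otimes> s = v \<otimes> (u \<otimes> s)"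
        using Mc[OF v] Mc[OF u] sc by (simp add: m_assoc)
      also have "\<dots> = b' \<otimes> (v \<otimes> y) \<oplus> v \<otimes> c'"
        unfolding us using Mc[OF v] Ac[OF b'] y prodc[OF c'] by algebra
      finally have eq: "(v \<otimes> u) \<otimes> s = b' \<otimes> c \<oplus> v \<otimes> c'" unfolding vy .
      have "b' \<otimes> c \<in> A ?d \<cdot> (Idl S)"
        by (rule mult_ideal_prod_left[OF Ac[OF b'] A idS AA[OF b'] c])
      moreover have "v \<otimes> c' \<in> A ?d \<cdot> (Idl S)"
        by (rule mult_ideal_prod_left[OF Mc[OF v] A idS MA[OF v] c'])
      ultimately show ?thesis using MM[OF v u] eq prodadd by (intro bexI[of _ "v \<otimes> u"]) auto
    qed
    from insert.hyps(3)[OF Sc rel'] obtain e w' where w': "w' \<in> M e"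
      and kill: "\<And>s. s \<in> S \<Longrightarrow> w' \<otimes> s = \<zero>" by blast
    have "c \<in> Idl S" using c ideal_prod_inter[OF A idS] by blast
    with kill have w'c: "w' \<otimes> c = \<zero>" by (rule annihilator_Idl[OF Mc[OF w'] Sc])
    have "(w' \<otimes> v) \<otimes> s = \<zero>" if s: "s \<in> insert y S" for s
    proof (cases "s = y")
      case True
      then show ?thesis using w'c vy Mc[OF w'] Mc[OF v] y by (simp add: m_assoc)
    next
      case False
      then have sS: "s \<in> S" and sc: "s \<in> carrier R" using s Sc by auto
      have "(w' \<otimes> v) \<otimes> s = v \<otimes> (w' \<otimes> s)" using Mc[OF w'] Mc[OF v] sc by (simp add: m_ac)
      then show ?thesis using kill[OF sS] Mc[OF v] by simp
    qed
    then show ?case using MM[OF w' v] by blast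
  qed
  moreover have "\<exists>w\<in>M d. w \<otimes> s \<in> A d \<cdot> (Idl S)" if "s \<in> S" for s
    using rel[OF that] unfolding M_def by blast
  ultimately show ?thesis unfolding M_def by blast
qed

text \<open>
  The elimination is applied with \<open>L = I + R x\<close> and \<open>A d = I L\<^sup>d\<close>, starting from the relations
  \<open>x s \<in> I J\<close> for the generators \<open>s\<close> of \<open>J\<close>. The monic element that it yields annihilates \<open>J\<close>,
  which contains a nonzerodivisor, so it vanishes; that is the required membership
  \<open>x\<^sup>e\<^sup>+\<^sup>1 \<in> I L\<^sup>e\<close>.
\<close>

lemma integral_if_mult_subset:
  assumes I: "ideal I R" and x: "x \<in> carrier R"
    and J: "regular_ideal J R" and fg: "finite S" "S \<subseteq> carrier R" "J = Idl S"
    and xJ: "\<And>j. j \<in> J \<Longrightarrow> x \<otimes> j \<in> I \<cdot> J"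
  shows "integral_over_ideal R I x"
proof -
  let ?L = "I <+> PIdl x"
  define A where "A = (\<lambda>d. I \<cdot> ideal_power R ?L d)"
  note L = ideal_adjoin(1)[OF I x] and IL = ideal_adjoin(2)[OF I x]
    and xL = ideal_adjoin(3)[OF I x]
  have idA: "ideal (A d) R" for d unfolding A_def using I L by (simp add: ideal_prod_is_ideal)
  have LA: "ideal_power R ?L (Suc d) \<cdot> A e = A (Suc (d + e))" for d e
    unfolding A_def using I L ideal_power_add[OF L, of "Suc d" e] by (simp add: ideal_prod_left_commute)
  have AL: "A d \<subseteq> ideal_power R ?L (Suc d)" for d
    unfolding A_def ideal_power_Suc[OF L] by (rule ideal_prod_mono[OF IL order_refl])
  have "\<exists>e. \<exists>a\<in>A e. \<forall>s\<in>S. (x [^] Suc e \<ominus> a) \<otimes> s = \<zero>"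
  proof (rule monic_elimination[OF idA x _ _ fg(1,2)])
    show "a \<otimes> b \<in> A (Suc (d + e))" if "a \<in> A d" "b \<in> A e" for a b d e
      using that AL LA by (metis ideal_prod.prod subsetD)
    show "x [^] Suc d \<otimes> b \<in> A (Suc (d + e))" if "b \<in> A e" for b d e
      using that LA pow_mem_ideal_power[OF L xL] by (metis ideal_prod.prod)
    show "\<exists>a\<in>A 0. (x [^] Suc 0 \<ominus> a) \<otimes> s \<in> A 0 \<cdot> (Idl S)" if s: "s \<in> S" for s
    proof (rule bexI)
      have "A 0 = I" unfolding A_def using I by (simp add: ideal_power_0 ideal_prod_one)
      moreover have "s \<in> J" using s genideal_self[OF fg(2)] fg(3) by auto
      ultimately show "(x [^] Suc 0 \<ominus> \<zero>) \<otimes> s \<in> A 0 \<cdot> (Idl S)"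
        using xJ[of s] fg(3) x by (simp add: a_minus_def nat_pow_Suc)
      show "\<zero> \<in> A 0" by (rule additive_subgroup.zero_closed[OF ideal.axioms(1)[OF idA]])
    qed
  qed
  then obtain e a where a: "a \<in> A e" and kill: "\<And>s. s \<in> S \<Longrightarrow> (x [^] Suc e \<ominus> a) \<otimes> s = \<zero>"
    by blast
  have ac: "a \<in> carrier R" using ideal.Icarr[OF idA a] .
  have Xc: "x [^] Suc e \<in> carrier R" using x by (rule nat_pow_closed)
  obtain j where j: "j \<in> J" and nz: "nonzerodivisor R j" using J by (auto simp: regular_ideal_def)
  have jc: "j \<in> carrier R" using nz by (simp add: nonzerodivisor_def)
  have "(x [^] Suc e \<ominus> a) \<otimes> j = \<zero>"
    by (rule annihilator_Idl[OF _ fg(2) kill]) (use j fg(3) Xc ac in auto)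
  then have "j \<otimes> (x [^] Suc e \<ominus> a) = \<zero>"
    using jc Xc ac by (metis m_comm minus_closed)
  then have "x [^] Suc e \<ominus> a = \<zero>"
    using nz Xc ac unfolding nonzerodivisor_def by (meson minus_closed)
  then have "x [^] Suc e = a" using Xc ac by (metis r_right_minus_eq)
  then have "x [^] Suc e \<in> I \<cdot> ideal_power R ?L e" using a unfolding A_def by simp
  then show ?thesis using integral_over_ideal_iff[OF I x] by blast
qed

section \<open>Colon ideals of the form \<open>(I J : J)\<close>\<close>

text \<open>
  This is the colon ideal \<open>(I J : J)\<close>. The name refers to reductions of ideals: for
  \<open>J = (I + R x)\<^sup>d\<close>, it contains \<open>x\<close> iff \<open>(I + R x)\<^sup>d\<^sup>+\<^sup>1 = I (I + R x)\<^sup>d\<close>.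
\<close>

definition reducing_elements :: "'a set \<Rightarrow> 'a set \<Rightarrow> 'a set"
  where "reducing_elements I J = {x \<in> carrier R. \<forall>j\<in>J. x \<otimes> j \<in> I \<cdot> J}"

lemma reducing_elements_ideal:
  assumes "ideal I R" "ideal J R"
  shows "ideal (reducing_elements I J) R"
proof -
  interpret J: ideal J R by fact
  interpret IJ: ideal "I \<cdot> J" R using assms by (rule ideal_prod_is_ideal)
  show ?thesis
  proof (rule idealI[OF ring_axioms])
    show "subgroup (reducing_elements I J) (add_monoid R)"
    proof (rule add.subgroupI)
      have "\<zero> \<in> reducing_elements I J" by (auto simp: reducing_elements_def J.Icarr)
      then show "reducing_elements I J \<noteq> {}" by blast
    qed (auto simp: reducing_elements_def J.Icarr l_minus l_distr)
    show "r \<otimes> a \<in> reducing_elements I J" if "a \<in> reducing_elements I J" "r \<in> carrier R" for a r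
      using that by (auto simp: reducing_elements_def J.Icarr m_assoc IJ.I_l_closed)
    then show "a \<otimes> r \<in> reducing_elements I J" if "a \<in> reducing_elements I J" "r \<in> carrier R" for a r
      using that by (simp add: m_comm reducing_elements_def)
  qed
qed

lemma reducing_elements_prod:
  assumes I: "ideal I R" and J: "ideal J R" and K: "ideal K R"
  shows "reducing_elements I J \<subseteq> reducing_elements I (J \<cdot> K)"
proof
  fix x assume x: "x \<in> reducing_elements I J"
  have "x \<otimes> z \<in> I \<cdot> (J \<cdot> K)" if "z \<in> J \<cdot> K" for z
    using mult_ideal_prod_left[OF _ J K _ that, of x "I \<cdot> J"] x
    by (auto simp: reducing_elements_def ideal_prod_assoc[OF I J K])
  then show "x \<in> reducing_elements I (J \<cdot> K)" using x by (auto simp: reducing_elements_def)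
qed

text \<open>
  If \<open>x\<^sup>d\<^sup>+\<^sup>1 \<in> I L\<^sup>d\<close> with \<open>L = I + R x\<close>, then \<open>x L\<^sup>d \<subseteq> L\<^sup>d\<^sup>+\<^sup>1 = I L\<^sup>d\<close>, so \<open>J = L\<^sup>d\<close> works; it is regular because \<open>L\<close>
  contains \<open>I\<close>.
\<close>

lemma integral_imp_reducing:
  assumes I: "regular_ideal I R" and x: "x \<in> integral_closure R I"
  shows "\<exists>J. regular_ideal J R \<and> x \<in> reducing_elements I J"
proof -
  have xc: "x \<in> carrier R" and int: "integral_over_ideal R I x"
    using x by (auto simp: integral_closure_def)
  have idI: "ideal I R" using I by (simp add: regular_ideal_def)
  let ?L = "I <+> PIdl x"
  note L = ideal_adjoin(1)[OF idI xc] and IL = ideal_adjoin(2)[OF idI xc]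
    and xL = ideal_adjoin(3)[OF idI xc]
  from int obtain d where d: "x [^] Suc d \<in> I \<cdot> ideal_power R ?L d"
    using integral_over_ideal_iff[OF idI xc] by blast
  let ?J = "ideal_power R ?L d"
  interpret IJ: ideal "I \<cdot> ?J" R using idI L by (simp add: ideal_prod_is_ideal)
  have "x \<otimes> j \<in> I \<cdot> ?J" if "j \<in> ?J" for j
  proof -
    have "x \<otimes> j \<in> ideal_power R ?L (Suc d)"
      using that xL by (simp add: ideal_power_Suc[OF L] ideal_prod.prod)
    then have "x \<otimes> j \<in> I \<cdot> ?J <+> PIdl (x [^] Suc d)"
      using ideal_power_adjoin_split_top[OF idI xc] by blast
    then obtain u v where "u \<in> I \<cdot> ?J" "v \<in> PIdl (x [^] Suc d)" "x \<otimes> j = u \<oplus> v" by (rule set_addE)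
    then show ?thesis using cgenideal_minimal[OF IJ.is_ideal d] by auto
  qed
  then have "x \<in> reducing_elements I ?J" using xc by (simp add: reducing_elements_def)
  moreover have "regular_ideal ?J R"
    by (rule regular_ideal_power[OF regular_ideal_mono[OF I IL L]])
  ultimately show ?thesis by blast
qed

lemma ideal_r_ideal_module:
  assumes I: "ideal I R" and J: "ideal J R"
  shows "ideal_r R I (ideal_module R J) = (\<Union>k\<in>{1..}. reducing_elements I (ideal_power R I k \<cdot> J))"
proof -
  have "ideal_power R I (Suc k) \<cdot> J = I \<cdot> (ideal_power R I k \<cdot> J)" for k
    using I J by (simp add: ideal_power_Suc ideal_prod_assoc)
  then show ?thesis
    unfolding ideal_r_def submodule_colon_def ideal_smult_ideal_module reducing_elements_def
    by (simp add: ideal_module_def)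
qed

end

lemma (in noetherian_ring) ideal_family_has_maximal:
  assumes "F \<noteq> {}" "\<And>I. I \<in> F \<Longrightarrow> ideal I R"
  shows "\<exists>M\<in>F. \<forall>I\<in>F. M \<subseteq> I \<longrightarrow> I = M"
proof (rule subset_Zorn_nonempty[OF assms(1)])
  fix C assume "C \<noteq> {}" and C: "subset.chain F C"
  have sub: "C \<subseteq> F" using C by (simp add: pred_on.chain_def)
  then have "C \<subseteq> {I. ideal I R}" using assms(2) by auto
  then have "subset.chain {I. ideal I R} C" using C by (simp add: pred_on.chain_def)
  then show "\<Union>C \<in> F" using ideal_chain_is_trivial[OF \<open>C \<noteq> {}\<close>] sub by auto
qed

theorem proposition4p5:
  fixes R :: "('a, 'b) ring_scheme"
  assumes "cring R" and "noetherian_ring R"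
    and "regular_ideal I R"
  shows "\<exists>J. regular_ideal J R \<and> ideal_r R I (ideal_module R J) = integral_closure R I"
proof -
  interpret cring R by fact
  interpret noetherian_ring R by fact
  have I: "ideal I R" using assms(3) by (simp add: regular_ideal_def)
  have reg_ideal: "ideal J R" if "regular_ideal J R" for J using that by (simp add: regular_ideal_def)
  let ?F = "reducing_elements I ` {J. regular_ideal J R}"
  have "\<exists>M\<in>?F. \<forall>K\<in>?F. M \<subseteq> K \<longrightarrow> K = M"
    using regular_ideal_carrier by (intro ideal_family_has_maximal)
      (auto intro: reducing_elements_ideal I reg_ideal)
  then obtain J where J: "regular_ideal J R"
    and max: "\<And>K. regular_ideal K R \<Longrightarrow> reducing_elements I J \<subseteq> reducing_elements I K \<Longrightarrow>
      reducing_elements I K = reducing_elements I J"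
    by auto
  \<comment> \<open>Directedness, with \<open>J K\<close> as the upper bound, turns the maximal member into the largest one.\<close>
  have top: "reducing_elements I K \<subseteq> reducing_elements I J" if K: "regular_ideal K R" for K
  proof -
    note ids = reg_ideal[OF J] reg_ideal[OF K]
    have "reducing_elements I K \<subseteq> reducing_elements I (J \<cdot>\<^bsub>R\<^esub> K)"
      using reducing_elements_prod[OF I ids(2,1)] ideal_prod_commute[OF ids] by simp
    then show ?thesis
      using max[OF regular_ideal_prod[OF J K] reducing_elements_prod[OF I ids]] by simp
  qed
  have "ideal_r R I (ideal_module R J) = integral_closure R I"
    unfolding ideal_r_ideal_module[OF I reg_ideal[OF J]]
  proof (intro equalityI subsetI)
    fix x assume "x \<in> (\<Union>k\<in>{1..}. reducing_elements I (ideal_power R I k \<cdot>\<^bsub>R\<^esub> J))"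
    then obtain k where x: "x \<in> reducing_elements I (ideal_power R I k \<cdot>\<^bsub>R\<^esub> J)" by blast
    let ?N = "ideal_power R I k \<cdot>\<^bsub>R\<^esub> J"
    have N: "regular_ideal ?N R"
      by (intro regular_ideal_prod regular_ideal_power assms(3) J)
    obtain S where S: "S \<subseteq> carrier R" "finite S" "?N = Idl\<^bsub>R\<^esub> S"
      using finetely_gen[OF reg_ideal[OF N]] by blast
    have xc: "x \<in> carrier R" using x by (simp add: reducing_elements_def)
    have "integral_over_ideal R I x"
      by (rule integral_if_mult_subset[OF I xc N S(2,1,3)]) (use x in \<open>simp add: reducing_elements_def\<close>)
    then show "x \<in> integral_closure R I" using xc by (simp add: integral_closure_def)
  next
    fix x assume "x \<in> integral_closure R I"
    then have "x \<in> reducing_elements I J"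
      using integral_imp_reducing[OF assms(3)] top by blast
    \<comment> \<open>The union starts at \<open>k = 1\<close>, so \<open>J\<close> has to be enlarged to \<open>I J\<close> first.\<close>
    also have "\<dots> \<subseteq> reducing_elements I (J \<cdot>\<^bsub>R\<^esub> ideal_power R I 1)"
      using I reg_ideal[OF J] by (intro reducing_elements_prod) auto
    also have "J \<cdot>\<^bsub>R\<^esub> ideal_power R I 1 = ideal_power R I 1 \<cdot>\<^bsub>R\<^esub> J"
      using I reg_ideal[OF J] by (intro ideal_prod_commute) auto
    finally show "x \<in> (\<Union>k\<in>{1..}. reducing_elements I (ideal_power R I k \<cdot>\<^bsub>R\<^esub> J))" by blast
  qed
  then show ?thesis using J by blast
qed

end
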